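(* Let $\mu$ be a complex measure on $2^{[n]}$ with (complex) stable generating polynomial. Then for any transposition $\tau\in\mathfrak{S}_n$ and any $\theta\in[0,1]$, the generating polynomial of the partial symmetrization $\mu^{\tau,\theta}=\theta\mu+(1-\theta)\tau(\mu)$ is (complex) stable.
   Context: Notation: $[n]=\{1,\dots,n\}$ and $\mathfrak{S}_n$ is the symmetric group on $[n]$. The generating polynomial of a complex measure $\mu$ on $2^{[n]}$ is $g_\mu(z_1,\dots,z_n)=\sum_{S\subseteq[n]}\mu(S)\prod_{i\in S}z_i\in\mathbb{C}[z_1,\dots,z_n]$. For $\sigma\in\mathfrak{S}_n$, $\sigma(\mu)$ is the measure defined by $\sigma(\mu)(S)=\mu(\sigma(S))$, where $\sigma(S)=\{\sigma(s):s\in S\}$. A polynomial $f\in\mathbb{C}[z_1,\dots,z_n]$ is stable if $f(z_1,\dots,z_n)\neq0$ whenever $\mathrm{Im}(z_j)>0$ for all $1\le j\le n$. *)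

theory Defs
  imports Complex_Main "HOL-Combinatorics.Transposition"
begin

text \<open>
  A complex measure on the subsets of \<open>{1..n}\<close> is given by its point masses, i.e. a function
  \<open>nat set \<Rightarrow> complex\<close>; only its values on subsets of \<open>{1..n}\<close> matter.
  Polynomials in \<open>n\<close> complex variables are identified with polynomial functions of
  \<open>z :: nat \<Rightarrow> complex\<close>, of which only the coordinates \<open>z 1, ..., z n\<close> are used.
\<close>

definition gen_poly :: "nat \<Rightarrow> (nat set \<Rightarrow> complex) \<Rightarrow> (nat \<Rightarrow> complex) \<Rightarrow> complex" where
  "gen_poly n \<mu> z = (\<Sum>S\<in>Pow {1..n}. \<mu> S * (\<Prod>i\<in>S. z i))"

definition stable_poly :: "nat \<Rightarrow> ((nat \<Rightarrow> complex) \<Rightarrow> complex) \<Rightarrow> bool" where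
  "stable_poly n f \<longleftrightarrow> (\<forall>z. (\<forall>j\<in>{1..n}. Im (z j) > 0) \<longrightarrow> f z \<noteq> 0)"

definition perm_measure :: "(nat \<Rightarrow> nat) \<Rightarrow> (nat set \<Rightarrow> complex) \<Rightarrow> nat set \<Rightarrow> complex" where
  "perm_measure \<sigma> \<mu> S = \<mu> (\<sigma> ` S)"

definition partial_symmetrization ::
  "(nat \<Rightarrow> nat) \<Rightarrow> real \<Rightarrow> (nat set \<Rightarrow> complex) \<Rightarrow> nat set \<Rightarrow> complex" where
  "partial_symmetrization \<tau> \<theta> \<mu> S =
     of_real \<theta> * \<mu> S + of_real (1 - \<theta>) * perm_measure \<tau> \<mu> S"

end

theory Submission
  imports Defs
begin

text \<open>
  Freezing all variables but the two exchanged by \<open>\<tau>\<close> leaves a biaffine polynomial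
  \<open>f(x, y) = a + b x + c y + d x y\<close> over \<open>\<complex>\<close>. With real coefficients, stability means
  \<open>b c \<ge> a d\<close>, and symmetrization can only increase \<open>b c\<close>. In the complex case write the
  symmetrized polynomial as \<open>F = G + i H\<close> with \<open>G\<close>, \<open>H\<close> real: every real combination of \<open>G\<close> and
  \<open>H\<close> satisfies that inequality, because the corresponding real combination coming from \<open>f\<close> does.
  Hence, unless \<open>F\<close> is a multiple of a real polynomial, \<open>Im (G * cnj H)\<close> has no zero and thus a
  constant sign on the product of two upper half-planes. As \<open>F = f\<close> on the diagonal, this sign is
  the positive one, whereas a zero of \<open>F\<close> would force it to be negative.
\<close>

definition biaffine :: "complex \<Rightarrow> complex \<Rightarrow> complex \<Rightarrow> complex \<Rightarrow> complex \<Rightarrow> complex \<Rightarrow> complex" where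
  "biaffine a b c d x y = a + b * x + c * y + d * x * y"

section \<open>Quadratics without zeros in the upper half-plane\<close>

lemma quadratic_factorization:
  fixes A B C :: complex
  assumes "C \<noteq> 0"
  obtains u v where "\<And>t. A + B * t + C * t\<^sup>2 = C * (t - u) * (t - v)"
    "A = C * u * v" "B = - C * (u + v)"
proof -
  define s where "s = csqrt (B\<^sup>2 - 4 * A * C)"
  have s: "s * s = B * B - 4 * A * C"
    using power2_csqrt[of "B\<^sup>2 - 4 * A * C"] by (simp add: s_def power2_eq_square)
  define u where "u = (- B + s) / (2 * C)"
  define v where "v = (- B - s) / (2 * C)"
  have B: "B = - C * (u + v)" using assms by (simp add: u_def v_def field_simps)
  have "C * u * v = (B * B - s * s) / (4 * C)"
    using assms by (simp add: u_def v_def field_simps)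
  then have A: "A = C * u * v" using assms s by (simp add: field_simps)
  show thesis
    by (rule that[of u v]) (simp_all only: A B, simp_all add: algebra_simps power2_eq_square)
qed

text \<open>Both roots \<open>u\<close>, \<open>v\<close> lie in the closed lower half-plane, so the
  difference of the two sides is a square plus 4 Im u Im v |C|^2, which is nonnegative.\<close>

lemma quadratic_stable_Re_discriminant:
  fixes A B C :: complex
  assumes "\<And>t. Im t > 0 \<Longrightarrow> A + B * t + C * t\<^sup>2 \<noteq> 0"
  shows "4 * Re A * Re C \<le> (Re B)\<^sup>2"
proof (cases "C = 0")
  case False
  then obtain u v where f: "\<And>t. A + B * t + C * t\<^sup>2 = C * (t - u) * (t - v)"
    and A: "A = C * u * v" and B: "B = - C * (u + v)"
    using quadratic_factorization by blast
  have u: "Im u \<le> 0" and v: "Im v \<le> 0"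
    using assms[of u] assms[of v] f[of u] f[of v] by force+
  have "(Re B)\<^sup>2 - 4 * Re A * Re C =
      (Re C * (Re u - Re v) - Im C * (Im u - Im v))\<^sup>2 + 4 * (Im u * Im v) * ((Re C)\<^sup>2 + (Im C)\<^sup>2)"
    unfolding A B by (simp add: algebra_simps power2_eq_square)
  moreover have "Im u * Im v \<ge> 0" using u v by (simp add: mult_nonpos_nonpos)
  ultimately have "(Re B)\<^sup>2 - 4 * Re A * Re C \<ge> 0" by simp
  then show ?thesis by simp
qed simp

lemma norm_diff_cnj_le:
  assumes "Im t > 0" "Im u \<le> 0"
  shows "cmod (cnj t - u) \<le> cmod (t - u)"
proof -
  have "(- Im t - Im u)\<^sup>2 \<le> (Im t - Im u)\<^sup>2"
    using assms mult_nonneg_nonpos[of "Im t" "Im u"] by (simp add: power2_eq_square algebra_simps)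
  then show ?thesis by (simp add: cmod_def)
qed

text \<open>Factor by factor: a root in the closed lower half-plane is no farther from
  \<open>cnj t\<close> than from \<open>t\<close>. Applied to a biaffine polynomial on the diagonal,
  this fixes the sign of |F| - |F'| there.\<close>

lemma quadratic_stable_norm_cnj_le:
  fixes A B C :: complex
  assumes st: "\<And>t. Im t > 0 \<Longrightarrow> A + B * t + C * t\<^sup>2 \<noteq> 0" and t: "Im t > 0"
  shows "cmod (A + B * cnj t + C * (cnj t)\<^sup>2) \<le> cmod (A + B * t + C * t\<^sup>2)"
proof (cases "C = 0")
  case False
  then obtain u v where f: "\<And>t. A + B * t + C * t\<^sup>2 = C * (t - u) * (t - v)"
    using quadratic_factorization by blast
  have u: "Im u \<le> 0" and v: "Im v \<le> 0"
    using st[of u] st[of v] f[of u] f[of v] by force+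
  show ?thesis
    unfolding f norm_mult
    by (intro mult_mono norm_diff_cnj_le t u v) auto
next
  case C: True
  show ?thesis
  proof (cases "B = 0")
    case False
    define u where "u = - A / B"
    have f: "A + B * t = B * (t - u)" for t
      using False by (simp add: u_def field_simps)
    have "Im u \<le> 0" using st[of u] f[of u] C by force
    then show ?thesis
      using C t by (simp add: f norm_mult mult_left_mono norm_diff_cnj_le)
  qed (simp add: C)
qed

section \<open>The discriminant inequality for biaffine polynomials\<close>

lemma biaffine_stable_Re_aux:
  assumes st: "\<And>x y. Im x > 0 \<Longrightarrow> Im y > 0 \<Longrightarrow> biaffine a b c d x y \<noteq> 0" and d: "Re d \<noteq> 0"
  shows "Re a * Re d \<le> Re b * Re c"
proof -
  \<comment> \<open>The line through the centre of the hyperbola cut out by the real parts.\<close>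
  define p where "p = - complex_of_real (Re c / Re d)"
  define q where "q = - complex_of_real (Re b / Re d)"
  \<comment> \<open>Since \<open>p\<close> and \<open>q\<close> are real, the points (p + t, q + t)
    stay in the upper half-planes. The centre makes the real part of the linear coefficient vanish,
    so the bound reduces to the claim.\<close>
  have "4 * Re (a + b * p + c * q + d * p * q) * Re d \<le> (Re (b + c + d * (p + q)))\<^sup>2"
  proof (rule quadratic_stable_Re_discriminant)
    fix t :: complex assume "Im t > 0"
    then have "biaffine a b c d (p + t) (q + t) \<noteq> 0"
      by (intro st) (simp_all add: p_def q_def)
    then show "a + b * p + c * q + d * p * q + (b + c + d * (p + q)) * t + d * t\<^sup>2 \<noteq> 0"
      by (simp add: biaffine_def algebra_simps power2_eq_square)
  qed
  moreover have "Re (b + c + d * (p + q)) = 0"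
    using d by (simp add: p_def q_def field_simps)
  moreover have "Re (a + b * p + c * q + d * p * q) * Re d = Re a * Re d - Re b * Re c"
    using d by (simp add: p_def q_def field_simps)
  ultimately show ?thesis by (simp only: mult.assoc) simp
qed

lemma biaffine_stable_Re:
  assumes st: "\<And>x y. Im x > 0 \<Longrightarrow> Im y > 0 \<Longrightarrow> biaffine a b c d x y \<noteq> 0"
  shows "Re a * Re d \<le> Re b * Re c"
proof -
  consider "Re d \<noteq> 0" | "Re c \<noteq> 0" | "Re d = 0" "Re c = 0" by blast
  then show ?thesis
  proof cases
    case 1
    then show ?thesis using biaffine_stable_Re_aux st by blast
  next
    case 2
    \<comment> \<open>The substitution \<open>x \<mapsto> -1/x\<close> preserves the half-plane and the discriminant.\<close>
    have "Re (- b) * Re c \<le> Re a * Re (- d)"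
    proof (rule biaffine_stable_Re_aux[OF _ 2])
      fix x y :: complex assume x: "Im x > 0" and y: "Im y > 0"
      then have "x \<noteq> 0" by auto
      have "Im (- 1 / x) > 0"
        using x by (simp add: Im_divide sum_power2_gt_zero_iff)
      then have "x * biaffine a b c d (- 1 / x) y \<noteq> 0" using st y \<open>x \<noteq> 0\<close> by simp
      moreover have "x * biaffine a b c d (- 1 / x) y = biaffine (- b) a (- d) c x y"
        using \<open>x \<noteq> 0\<close> by (simp add: biaffine_def field_simps)
      ultimately show "biaffine (- b) a (- d) c x y \<noteq> 0"
        by argo
    qed
    then show ?thesis by simp
  qed simp
qed

lemma biaffine_of_real_nonzero:
  fixes a b c d :: real
  assumes "a * d \<le> b * c" "(a, b, c, d) \<noteq> (0, 0, 0, 0)" and x: "Im x > 0" and y: "Im y > 0"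
  shows "biaffine (of_real a) (of_real b) (of_real c) (of_real d) x y \<noteq> 0"
proof
  assume z: "biaffine (of_real a) (of_real b) (of_real c) (of_real d) x y = 0"
  have re: "a + b * Re x + c * Re y + d * (Re x * Re y - Im x * Im y) = 0"
    and im: "b * Im x + c * Im y + d * (Re x * Im y + Im x * Re y) = 0"
    using arg_cong[OF z, of Re] arg_cong[OF z, of Im]
    by (simp_all add: biaffine_def algebra_simps)
  show False
  proof (cases "d = 0")
    case True
    then have im': "b * Im x = - (c * Im y)" and bc: "b * c \<ge> 0" using im assms by auto
    have "b * b * Im x = - (b * c * Im y)" using im' by (simp add: algebra_simps)
    also have "\<dots> \<le> 0" using bc y by simp
    finally have "b * b \<le> 0" using x by (simp add: mult_le_0_iff)
    then have "b = 0" using zero_le_square[of b] by (metis antisym mult_eq_0_iff)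
    then have "c = 0" using im' y by simp
    then show False using \<open>b = 0\<close> True re assms(2) by simp
  next
    case False
    \<comment> \<open>These are the real parts of d x + c and d y + b, whose product at a zero is b
      c - a d. Comparing real parts makes \<open>p * q\<close> positive; comparing imaginary parts
      gives \<open>p\<close> and \<open>q\<close> opposite signs.\<close>
    define p where "p = d * Re x + c"
    define q where "q = d * Re y + b"
    have 1: "p * q - d * d * (Im x * Im y) = b * c - a * d"
    proof -
      have "p * q - d * d * (Im x * Im y) - (b * c - a * d) =
          d * (a + b * Re x + c * Re y + d * (Re x * Re y - Im x * Im y))"
        by (simp add: p_def q_def algebra_simps)
      then show ?thesis using re by simp
    qed
    have 2: "p * Im y = - (q * Im x)"
      using im by (simp add: p_def q_def algebra_simps)
    have "d * d * (Im x * Im y) > 0"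
      using False x y by (simp add: zero_less_mult_iff) linarith
    then have "p * q > 0" using 1 assms(1) by linarith
    then have "p * q * Im y > 0" using y by simp
    moreover have "p * q * Im y = - (q * q * Im x)"
      using arg_cong[OF 2, of "times q"] by (simp only: ac_simps mult_minus_right)
    moreover have "q * q * Im x \<ge> 0" using x by simp
    ultimately show False by linarith
  qed
qed

lemma mix_prod_ge:
  fixes b c \<theta> :: real
  assumes "0 \<le> \<theta>" "\<theta> \<le> 1"
  shows "b * c \<le> (\<theta> * b + (1 - \<theta>) * c) * (\<theta> * c + (1 - \<theta>) * b)"
proof -
  have "(\<theta> * b + (1 - \<theta>) * c) * (\<theta> * c + (1 - \<theta>) * b) - b * c = \<theta> * (1 - \<theta>) * (b - c)\<^sup>2"
    by (simp add: algebra_simps power2_eq_square)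
  moreover have "\<theta> * (1 - \<theta>) * (b - c)\<^sup>2 \<ge> 0" using assms by simp
  ultimately show ?thesis by linarith
qed

section \<open>Complex biaffine polynomials and their symmetrization\<close>

lemma biaffine_stableI:
  assumes disc: "\<And>w. Re (w * a) * Re (w * d) \<le> Re (w * b) * Re (w * c)"
    and diag: "\<And>t. Im t > 0 \<Longrightarrow> biaffine a b c d t t \<noteq> 0"
    and x: "Im x > 0" and y: "Im y > 0"
  shows "biaffine a b c d x y \<noteq> 0"
proof
  assume zero: "biaffine a b c d x y = 0"
  define F where "F = biaffine a b c d"
  \<comment> \<open>In terms of \<open>F = G + i H\<close>, \<open>F'\<close> is \<open>G - i H\<close>, so \<open>|F|\<^sup>2 - |F'|\<^sup>2 = 4 Im (G * cnj H)\<close>, and the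
    \<open>R w\<close> are the real combinations of \<open>G\<close> and \<open>H\<close>.\<close>
  define F' where "F' = (\<lambda>x y. cnj (F (cnj x) (cnj y)))"
  define R where "R = (\<lambda>w. biaffine (of_real (Re (w * a))) (of_real (Re (w * b)))
    (of_real (Re (w * c))) (of_real (Re (w * d))))"
  have R_eq: "2 * R w x y = w * F x y + cnj w * F' x y" for w x y
  proof -
    have 1: "complex_of_real (Re z) = (z + cnj z) / 2" for z
      by (simp add: complex_add_cnj)
    show ?thesis
      unfolding R_def F_def F'_def biaffine_def 1 by (simp add: field_simps)
  qed
  have R_nz: "R w u v \<noteq> 0"
    if "Im u > 0" "Im v > 0" "(Re (w * a), Re (w * b), Re (w * c), Re (w * d)) \<noteq> (0, 0, 0, 0)" for w u v
    unfolding R_def using that disc[of w] by (intro biaffine_of_real_nonzero) simp_all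
  \<comment> \<open>Otherwise w F is \<i> times a real polynomial, again one of the
    \<open>R\<close>. It vanishes at (x, y), hence identically by \<open>R_nz\<close>, contradicting
    \<open>diag\<close>.\<close>
  have R_coeffs: "(Re (w * a), Re (w * b), Re (w * c), Re (w * d)) \<noteq> (0, 0, 0, 0)" if "w \<noteq> 0" for w
  proof
    assume w: "(Re (w * a), Re (w * b), Re (w * c), Re (w * d)) = (0, 0, 0, 0)"
    have 1: "w * z = \<i> * of_real (Re (- \<i> * w * z))" if "Re (w * z) = 0" for z
      using that by (simp add: complex_eq_iff)
    have wF: "w * F u v = \<i> * R (- \<i> * w) u v" for u v
    proof -
      have "w * F u v = w * a + w * b * u + w * c * v + w * d * u * v"
        by (simp add: F_def biaffine_def algebra_simps)
      then show ?thesis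
        using w unfolding R_def biaffine_def
        by (subst (asm) (1 2 3 4) 1) (simp_all add: algebra_simps)
    qed
    have "R (- \<i> * w) x y = 0" using wF[of x y] zero by (simp add: F_def)
    then have "(Re (- \<i> * w * a), Re (- \<i> * w * b), Re (- \<i> * w * c), Re (- \<i> * w * d)) = (0, 0, 0, 0)"
      using R_nz x y by blast
    then have "R (- \<i> * w) x x = 0" unfolding R_def biaffine_def by simp
    then show False using wF[of x x] \<open>w \<noteq> 0\<close> diag[OF x] by (simp add: F_def)
  qed
  have norm_ne: "cmod (F u v) \<noteq> cmod (F' u v)" if "Im u > 0" "Im v > 0" for u v
  proof
    assume eq: "cmod (F u v) = cmod (F' u v)"
    \<comment> \<open>Where F is nonzero, \<open>w\<close> is a square root of -F'/F; it has modulus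
      1, so \<open>cnj w\<close> is its inverse and the sum vanishes.\<close>
    obtain w where "w \<noteq> 0" "w * F u v + cnj w * F' u v = 0"
    proof (cases "F u v = 0")
      case True
      then show thesis using eq that[of 1] by simp
    next
      case False
      define w where "w = csqrt (- F' u v / F u v)"
      have w2: "w * w = - F' u v / F u v"
        using power2_csqrt[of "- F' u v / F u v"] by (simp add: w_def power2_eq_square)
      have "cmod (w * w) = 1" unfolding w2 using eq False by (metis divide_self norm_divide norm_eq_zero norm_minus_cancel)
      then have "cmod w * cmod w = 1" by (simp add: norm_mult)
      then have "w * cnj w = 1"
        by (metis complex_norm_square of_real_1 power2_eq_square)
      have "w * F u v + cnj w * F' u v = cnj w * (w * w * F u v + F' u v) + (1 - w * cnj w) * w * F u v"
        by (simp add: algebra_simps)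
      also have "\<dots> = 0" using \<open>w * cnj w = 1\<close> False by (simp add: w2)
      finally show thesis using that[of w] \<open>w * cnj w = 1\<close> by force
    qed
    then have "R w u v = 0" using R_eq[of w u v] by simp
    then show False using R_nz[OF that R_coeffs[OF \<open>w \<noteq> 0\<close>]] by simp
  qed
  \<comment> \<open>The second argument moves along the segment from \<open>y\<close>, where F
    vanishes, to the diagonal point \<open>x\<close>. A sign change of \<open>\<psi>\<close> on the
    way would contradict \<open>norm_ne\<close>.\<close>
  define p where "p = (\<lambda>s::real. of_real (1 - s) * y + of_real s * x)"
  define \<psi> where "\<psi> = (\<lambda>s. cmod (F x (p s)) - cmod (F' x (p s)))"
  have "\<psi> 0 \<le> 0" using zero by (simp add: \<psi>_def p_def F_def)
  moreover have "\<psi> 1 \<ge> 0"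
  proof -
    have q: "F t t = a + (b + c) * t + d * t\<^sup>2" for t
      by (simp add: F_def biaffine_def algebra_simps power2_eq_square)
    have "cmod (F (cnj x) (cnj x)) \<le> cmod (F x x)"
      unfolding q by (rule quadratic_stable_norm_cnj_le) (use diag x in \<open>simp_all flip: q add: F_def\<close>)
    then show ?thesis by (simp add: \<psi>_def p_def F'_def)
  qed
  moreover have "continuous_on {0..1} \<psi>"
    unfolding \<psi>_def F'_def F_def biaffine_def p_def by (intro continuous_intros)
  ultimately obtain s where s: "0 \<le> s" "s \<le> 1" "\<psi> s = 0"
    using IVT'[of \<psi> 0 0 1] by auto
  have "Im (p s) > 0"
  proof (cases "s = 0")
    case False
    then have "s * Im x > 0" "(1 - s) * Im y \<ge> 0" using s x y by auto
    then show ?thesis by (simp add: p_def algebra_simps)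
  qed (simp add: p_def y)
  then show False using norm_ne[OF x, of "p s"] s(3) by (simp add: \<psi>_def)
qed

text \<open>Swapping the arguments exchanges \<open>b\<close> and \<open>c\<close>. Mixing therefore
  keeps \<open>a\<close>, \<open>d\<close> and b + c, hence the values on the diagonal, and
  \<open>mix_prod_ge\<close> preserves the discriminant inequality of every multiple by
  \<open>w\<close>.\<close>

lemma biaffine_partial_symmetrization_stable:
  assumes st: "\<And>x y. Im x > 0 \<Longrightarrow> Im y > 0 \<Longrightarrow> biaffine a b c d x y \<noteq> 0"
    and \<theta>: "0 \<le> \<theta>" "\<theta> \<le> 1" and x: "Im x > 0" and y: "Im y > 0"
  shows "of_real \<theta> * biaffine a b c d x y + of_real (1 - \<theta>) * biaffine a b c d y x \<noteq> 0"
proof -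
  define b' where "b' = of_real \<theta> * b + of_real (1 - \<theta>) * c"
  define c' where "c' = of_real \<theta> * c + of_real (1 - \<theta>) * b"
  have F: "of_real \<theta> * biaffine a b c d x y + of_real (1 - \<theta>) * biaffine a b c d y x
      = biaffine a b' c' d x y" for x y
    by (simp add: biaffine_def b'_def c'_def algebra_simps)
  have "biaffine a b' c' d x y \<noteq> 0"
  proof (rule biaffine_stableI[OF _ _ x y])
    fix w
    show "Re (w * a) * Re (w * d) \<le> Re (w * b') * Re (w * c')"
    proof (cases "w = 0")
      case False
      have "w * biaffine a b c d u v = biaffine (w * a) (w * b) (w * c) (w * d) u v" for u v
        by (simp add: biaffine_def algebra_simps)
      then have "Re (w * a) * Re (w * d) \<le> Re (w * b) * Re (w * c)"
        using st False by (intro biaffine_stable_Re) (metis mult_eq_0_iff)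
      also have "\<dots> \<le> Re (w * b') * Re (w * c')"
        using mix_prod_ge[OF \<theta>, of "Re (w * b)" "Re (w * c)"]
        by (simp add: b'_def c'_def algebra_simps)
      finally show ?thesis .
    qed simp
  next
    fix t :: complex assume "Im t > 0"
    then show "biaffine a b' c' d t t \<noteq> 0"
      using st[of t t] F[of t t] by (simp flip: distrib_right of_real_add)
  qed
  then show ?thesis by (simp only: F not_False_eq_True)
qed

section \<open>Generating polynomials in two of their variables\<close>

lemma gen_poly_biaffine:
  assumes "i \<noteq> j"
  obtains a b c d where "\<And>x y. gen_poly n \<mu> (z(i := x, j := y)) = biaffine a b c d x y"
proof -
  define m where "m = (\<lambda>S. \<mu> S * (\<Prod>k\<in>S - {i, j}. z k))"
  \<comment> \<open>\<open>e p q\<close> collects the sets by membership of \<open>i\<close> and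
    \<open>j\<close>. The tests against \<open>True\<close> and \<open>False\<close> below match its
    unfolded instances literally.\<close>
  define e where "e = (\<lambda>p q. \<Sum>S\<in>Pow {1..n}. if (i \<in> S) = p \<and> (j \<in> S) = q then m S else 0)"
  have monomial: "\<mu> S * (\<Prod>k\<in>S. (z(i := x, j := y)) k) =
      biaffine (if (i \<in> S) = False \<and> (j \<in> S) = False then m S else 0)
        (if (i \<in> S) = True \<and> (j \<in> S) = False then m S else 0)
        (if (i \<in> S) = False \<and> (j \<in> S) = True then m S else 0)
        (if (i \<in> S) = True \<and> (j \<in> S) = True then m S else 0) x y"
    if "finite S" for S x y
  proof -
    have "(\<Prod>k\<in>S. (z(i := x, j := y)) k) =
        (\<Prod>k\<in>S \<inter> {i, j}. (z(i := x, j := y)) k) * (\<Prod>k\<in>S - {i, j}. (z(i := x, j := y)) k)"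
      using prod.Int_Diff[OF that] by blast
    also have "(\<Prod>k\<in>S - {i, j}. (z(i := x, j := y)) k) = (\<Prod>k\<in>S - {i, j}. z k)"
      by (rule prod.cong) auto
    also have "(\<Prod>k\<in>S \<inter> {i, j}. (z(i := x, j := y)) k) =
        (if i \<in> S then x else 1) * (if j \<in> S then y else 1)"
      using assms by (auto simp: Int_insert_right)
    finally show ?thesis by (simp only: m_def biaffine_def) simp
  qed
  have "gen_poly n \<mu> (z(i := x, j := y)) =
      biaffine (e False False) (e True False) (e False True) (e True True) x y" for x y
  proof -
    have "gen_poly n \<mu> (z(i := x, j := y)) = (\<Sum>S\<in>Pow {1..n}. biaffine
        (if (i \<in> S) = False \<and> (j \<in> S) = False then m S else 0)
        (if (i \<in> S) = True \<and> (j \<in> S) = False then m S else 0)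
        (if (i \<in> S) = False \<and> (j \<in> S) = True then m S else 0)
        (if (i \<in> S) = True \<and> (j \<in> S) = True then m S else 0) x y)"
      unfolding gen_poly_def
      by (intro sum.cong refl monomial) (auto intro: finite_subset)
    then show ?thesis
      unfolding biaffine_def e_def by (simp only: sum.distrib sum_distrib_right)
  qed
  then show thesis by (rule that)
qed

text \<open>An involution is its own inverse, so reindexing by \<open>image \<sigma>\<close>
  permutes the variables by \<open>\<sigma>\<close> itself.\<close>

lemma gen_poly_perm_measure:
  assumes \<sigma>: "bij_betw \<sigma> {1..n} {1..n}" and inv: "\<And>k. \<sigma> (\<sigma> k) = k"
  shows "gen_poly n (perm_measure \<sigma> \<mu>) z = gen_poly n \<mu> (z \<circ> \<sigma>)"
  unfolding gen_poly_def perm_measure_def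
proof (rule sum.reindex_bij_witness[of _ "image \<sigma>" "image \<sigma>"])
  fix S assume "S \<in> Pow {1..n}"
  have "inj_on \<sigma> S" by (metis inv inj_onI)
  then show "\<mu> (\<sigma> ` S) * (\<Prod>k\<in>\<sigma> ` S. (z \<circ> \<sigma>) k) = \<mu> (\<sigma> ` S) * (\<Prod>k\<in>S. z k)"
    by (simp add: prod.reindex inv)
qed (use bij_betw_imp_surj_on[OF \<sigma>] inv in \<open>auto simp: image_image\<close>)

lemma gen_poly_partial_symmetrization:
  "gen_poly n (partial_symmetrization \<tau> \<theta> \<mu>) z =
    of_real \<theta> * gen_poly n \<mu> z + of_real (1 - \<theta>) * gen_poly n (perm_measure \<tau> \<mu>) z"
  by (simp add: gen_poly_def partial_symmetrization_def sum.distrib sum_distrib_left distrib_right mult.assoc)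

theorem theorem4p20:
  fixes n :: nat and \<mu> :: "nat set \<Rightarrow> complex" and \<tau> :: "nat \<Rightarrow> nat" and \<theta> :: real
  assumes "stable_poly n (gen_poly n \<mu>)"
    and "\<exists>i\<in>{1..n}. \<exists>j\<in>{1..n}. i \<noteq> j \<and> \<tau> = Transposition.transpose i j"
    and "\<theta> \<in> {0..1}"
  shows "stable_poly n (gen_poly n (partial_symmetrization \<tau> \<theta> \<mu>))"
  unfolding stable_poly_def
proof (intro allI impI)
  fix z :: "nat \<Rightarrow> complex" assume z: "\<forall>k\<in>{1..n}. Im (z k) > 0"
  obtain i j where ij: "i \<in> {1..n}" "j \<in> {1..n}" "i \<noteq> j" and \<tau>: "\<tau> = Transposition.transpose i j"
    using assms(2) by blast
  obtain a b c d where f: "\<And>x y. gen_poly n \<mu> (z(i := x, j := y)) = biaffine a b c d x y"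
    using gen_poly_biaffine[OF ij(3)] by blast
  have nz: "biaffine a b c d x y \<noteq> 0" if "Im x > 0" "Im y > 0" for x y
    using assms(1) z that unfolding f[symmetric] stable_poly_def by simp
  have "bij_betw \<tau> {1..n} {1..n}"
    unfolding \<tau> using ij by simp
  then have "gen_poly n (perm_measure \<tau> \<mu>) z = gen_poly n \<mu> (z \<circ> \<tau>)"
    by (rule gen_poly_perm_measure) (simp add: \<tau>)
  also have "z \<circ> \<tau> = z(i := z j, j := z i)"
    by (auto simp: \<tau> Transposition.transpose_def)
  finally have "gen_poly n (partial_symmetrization \<tau> \<theta> \<mu>) z =
      of_real \<theta> * biaffine a b c d (z i) (z j) + of_real (1 - \<theta>) * biaffine a b c d (z j) (z i)"
    using f[of "z i" "z j"] by (simp only: f gen_poly_partial_symmetrization fun_upd_triv)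
  also have "\<dots> \<noteq> 0"
    using nz assms(3) z ij by (intro biaffine_partial_symmetrization_stable) auto
  finally show "gen_poly n (partial_symmetrization \<tau> \<theta> \<mu>) z \<noteq> 0" .
qed

end
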